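(* Let $\upsilon\ge1$ be an integer, $q>-1$ and $p$ real, and $s\ge0$ an integer with $s<\frac{p-1}{2}$. With $D_t=\partial/\partial t$ and $D_w=\partial/\partial w$, $$D_t\left[(1-D_w)^{\upsilon}-1\right]{}_K\mathcal N_{s;\upsilon}^{(p,q)}(t,w)=s(p-s-1)\,(1-D_w)^{\upsilon}\;{}_K\mathcal N_{s-1;\upsilon}^{(p-2,q)}(t,w),$$ where for $s=0$ the right-hand side is understood to be $0$.
   Context: $(a)_n$ is the Pochhammer symbol. The second set of finite bivariate biorthogonal N-Konhauser polynomials is $${}_K\mathcal N_{s;\upsilon}^{(p,q)}(t,w)=N_s^{(p)}(t)\sum_{k=0}^{s}Y_k^{(q)}(w;\upsilon),$$ where $$N_s^{(p)}(t)=(-1)^s\sum_{k=0}^{s}k!\binom{p-s-1}{k}\binom{s}{s-k}(-t)^k$$ and $$Y_s^{(q)}(w;\upsilon)=\frac1{s!}\sum_{m=0}^{s}\frac{w^m}{m!}\sum_{l=0}^{m}(-1)^l\binom ml\left(\frac{q+l+1}{\upsilon}\right)_s .$$ *)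

theory Defs
  imports "HOL-Analysis.Analysis"
begin

definition N_poly :: "nat \<Rightarrow> real \<Rightarrow> real \<Rightarrow> real" where
  "N_poly s p t =
     (-1) ^ s * (\<Sum>k=0..s. fact k * ((p - real s - 1) gchoose k) * real (s choose (s - k)) * (- t) ^ k)"

definition Konhauser_Y :: "nat \<Rightarrow> real \<Rightarrow> nat \<Rightarrow> real \<Rightarrow> real" where
  "Konhauser_Y s q \<upsilon> w =
     1 / fact s * (\<Sum>m=0..s. w ^ m / fact m *
        (\<Sum>l=0..m. (-1) ^ l * real (m choose l) * pochhammer ((q + real l + 1) / real \<upsilon>) s))"

definition N_Konhauser :: "nat \<Rightarrow> nat \<Rightarrow> real \<Rightarrow> real \<Rightarrow> real \<Rightarrow> real \<Rightarrow> real" where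
  "N_Konhauser s \<upsilon> p q t w = N_poly s p t * (\<Sum>k=0..s. Konhauser_Y k q \<upsilon> w)"

text \<open>The total function \<^const>\<open>deriv\<close> is
  unspecified at points of non-differentiability; here it is only applied to polynomials.\<close>

definition D\<^sub>t :: "(real \<Rightarrow> real \<Rightarrow> real) \<Rightarrow> real \<Rightarrow> real \<Rightarrow> real" where
  "D\<^sub>t f = (\<lambda>t w. deriv (\<lambda>x. f x w) t)"

definition D\<^sub>w :: "(real \<Rightarrow> real \<Rightarrow> real) \<Rightarrow> real \<Rightarrow> real \<Rightarrow> real" where
  "D\<^sub>w f = (\<lambda>t w. deriv (\<lambda>y. f t y) w)"

text \<open>In \<open>1 - D_w\<close> and \<open>A - 1\<close>, \<open>1\<close> is the identity operator; powers of operators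
  are iterated composition \<open>^^\<close>.\<close>

definition one_minus_D\<^sub>w :: "(real \<Rightarrow> real \<Rightarrow> real) \<Rightarrow> real \<Rightarrow> real \<Rightarrow> real" where
  "one_minus_D\<^sub>w f = (\<lambda>t w. f t w - D\<^sub>w f t w)"

definition minus_one_op ::
  "((real \<Rightarrow> real \<Rightarrow> real) \<Rightarrow> real \<Rightarrow> real \<Rightarrow> real) \<Rightarrow> (real \<Rightarrow> real \<Rightarrow> real) \<Rightarrow> real \<Rightarrow> real \<Rightarrow> real" where
  "minus_one_op A f = (\<lambda>t w. A f t w - f t w)"

end

theory Submission
  imports Defs
begin

text \<open>
  Everything is a product of a function of \<open>t\<close> and a function of \<open>w\<close>, so the identity
  splits into two one-variable facts.

  In the variable \<open>t\<close>, differentiating \<open>N_s^{(p)}\<close> term by term and absorbing a factor into each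
  of the two binomial coefficients gives \<open>s (p - s - 1)\<close> times \<open>N_{s-1}\<close> with parameter \<open>p - 2\<close>
  (\<open>has_real_derivative_N_poly\<close>). This accounts for the constant and for the shift in \<open>p\<close>.

  In the variable \<open>w\<close>, the coefficient of \<open>w^m / m!\<close> in \<open>Y_k\<close> is a finite difference
  \<open>(1 - E)^m g\<close> at \<open>0\<close>, where \<open>(E g)(l) = g (l + 1)\<close> and \<open>g(l) = (x_l)_k / k!\<close> with
  \<open>x_l = (q + l + 1) / \<upsilon>\<close>. Differentiation moves the coefficients down by one place, so
  \<open>1 - D_w\<close> replaces \<open>(1 - E)^m g\<close> by \<open>(1 - E)^m g - (1 - E)^{m+1} g = (1 - E)^m E g\<close>: it shifts
  the generating sequence \<open>g\<close> (\<open>one_minus_D\<^sub>w_transform_poly\<close>). The truncation of the sum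
  at \<open>m = k\<close> is harmless, because \<open>g\<close> is a polynomial in \<open>l\<close> of degree at most \<open>k\<close> and its higher
  differences vanish (\<open>binomial_transform_pochhammer_eq_0\<close>). A shift by \<open>\<upsilon>\<close> places raises every
  \<open>x_l\<close> by exactly \<open>1\<close>, so \<open>(1 - D_w)^\<upsilon>\<close> replaces \<open>x_l\<close> by \<open>x_l + 1\<close>.

  The identity \<open>(x + 1)_n / n! = (x + 1)_{n-1} / (n-1)! + (x)_n / n!\<close> is then used twice. Summed,
  it shows that \<open>Y_0 + \<dots> + Y_s\<close> is generated by \<open>(x_l + 1)_s / s!\<close>; applied
  at \<open>x_l + 1\<close>, it shows that \<open>(1 - D_w)^\<upsilon> - 1\<close> turns this sum into the polynomial generated by
  \<open>(x_l + 2)_{s-1} / (s-1)!\<close>, which is \<open>(1 - D_w)^\<upsilon>\<close> of \<open>Y_0 + \<dots> + Y_{s-1}\<close>.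
  For \<open>s = 0\<close> the sum is the constant \<open>1\<close>, which \<open>(1 - D_w)^\<upsilon> - 1\<close> annihilates.
\<close>

section \<open>Alternating binomial sums\<close>

definition binomial_transform :: "(nat \<Rightarrow> real) \<Rightarrow> nat \<Rightarrow> real" where
  "binomial_transform g m = (\<Sum>l\<le>m. (-1) ^ l * real (m choose l) * g l)"

definition transform_poly :: "nat \<Rightarrow> (nat \<Rightarrow> real) \<Rightarrow> real \<Rightarrow> real" where
  "transform_poly M g w = (\<Sum>m\<le>M. w ^ m / fact m * binomial_transform g m)"

lemma binomial_transform_add:
  "binomial_transform (\<lambda>l. g l + h l) m = binomial_transform g m + binomial_transform h m"
  by (simp add: binomial_transform_def distrib_left sum.distrib)

lemma binomial_transform_cmult:
  "binomial_transform (\<lambda>l. c * g l) m = c * binomial_transform g m"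
  by (simp add: binomial_transform_def sum_distrib_left mult_ac)

text \<open>
  Pascal's rule; in operator form, \<open>(1 - E)^m E = (1 - E)^m - (1 - E)^{m+1}\<close>.
\<close>
lemma binomial_transform_shift:
  "binomial_transform (\<lambda>l. g (Suc l)) m = binomial_transform g m - binomial_transform g (Suc m)"
proof -
  have "binomial_transform g (Suc m) =
      g 0 + (\<Sum>l\<le>m. (-1) ^ Suc l * real (Suc m choose Suc l) * g (Suc l))"
    unfolding binomial_transform_def by (subst sum.atMost_Suc_shift) simp
  also have "\<dots> = g 0 + (\<Sum>l\<le>m. (-1) ^ Suc l * real (m choose Suc l) * g (Suc l))
      - binomial_transform (\<lambda>l. g (Suc l)) m"
    by (simp add: binomial_transform_def algebra_simps sum.distrib sum_subtractf sum_negf)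
  also have "g 0 + (\<Sum>l\<le>m. (-1) ^ Suc l * real (m choose Suc l) * g (Suc l)) =
      (\<Sum>l\<le>Suc m. (-1) ^ l * real (m choose l) * g l)"
    by (subst sum.atMost_Suc_shift) simp
  also have "\<dots> = binomial_transform g m"
    by (simp add: binomial_transform_def)
  finally show ?thesis by simp
qed

text \<open>
  Multiplication of the sequence by its index lowers the order of the difference by one. This is
  what makes the vanishing below an induction on the number of linear factors.
\<close>
lemma binomial_transform_of_nat_mult:
  "binomial_transform (\<lambda>l. real l * g l) (Suc m) =
    - real (Suc m) * binomial_transform (\<lambda>l. g (Suc l)) m"
proof -
  have absorb: "real (Suc m choose Suc l) * real (Suc l) = real (Suc m) * real (m choose l)" for l
    unfolding of_nat_mult [symmetric] by (simp only: Suc_times_binomial_eq)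
  have "binomial_transform (\<lambda>l. real l * g l) (Suc m) =
      (\<Sum>l\<le>m. (-1) ^ Suc l * (real (Suc m choose Suc l) * real (Suc l)) * g (Suc l))"
    unfolding binomial_transform_def
    by (subst sum.atMost_Suc_shift) (simp add: mult.assoc del: binomial_Suc_Suc)
  also have "\<dots> = - real (Suc m) * binomial_transform (\<lambda>l. g (Suc l)) m"
    unfolding absorb binomial_transform_def sum_distrib_left
    by (intro sum.cong refl) (simp del: of_nat_Suc)
  finally show ?thesis .
qed

text \<open>
  A difference of order greater than the degree kills a polynomial. Peeling off the last factor
  \<open>a l + b + s\<close> of the Pochhammer symbol leaves differences of order \<open>m - 1\<close> and \<open>m\<close> of a product
  of \<open>s\<close> factors.
\<close>
lemma binomial_transform_pochhammer_eq_0: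
  "s < m \<Longrightarrow> binomial_transform (\<lambda>l. pochhammer (a * real l + b) s) m = 0"
proof (induction s arbitrary: m)
  case 0
  then obtain n where "m = Suc n" by (cases m) auto
  then show ?case
    using binomial_transform_shift [of "\<lambda>_. 1" n] by simp
next
  case (Suc s)
  let ?g = "\<lambda>l. pochhammer (a * real l + b) s"
  obtain n where m: "m = Suc n" "s < n"
    using Suc.prems by (cases m) auto
  have "(\<lambda>l. pochhammer (a * real l + b) (Suc s)) =
      (\<lambda>l. a * (real l * ?g l) + (b + real s) * ?g l)"
    by (simp add: pochhammer_Suc algebra_simps)
  then show ?case
    using Suc.IH [of n] Suc.IH [of "Suc n"] m binomial_transform_shift [of ?g n]
    by (simp add: binomial_transform_add binomial_transform_cmult
        binomial_transform_of_nat_mult)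
qed

section \<open>Differentiation as a shift of the generating sequence\<close>

lemma transform_poly_add:
  "transform_poly M (\<lambda>l. g l + h l) w = transform_poly M g w + transform_poly M h w"
  by (simp add: transform_poly_def binomial_transform_add distrib_left sum.distrib)

lemma transform_poly_eq_of_le:
  assumes "M \<le> N" "\<And>m. m > M \<Longrightarrow> binomial_transform g m = 0"
  shows "transform_poly N g w = transform_poly M g w"
  unfolding transform_poly_def
  by (rule sum.mono_neutral_right) (use assms in auto)

text \<open>
  The last term is the defect caused by truncation: it disappears when the difference of
  order \<open>M + 1\<close> vanishes, and keeping it makes the induction on \<open>M\<close> go through for every \<open>g\<close>.
\<close>
lemma has_real_derivative_transform_poly:
  "(transform_poly M g has_real_derivative
     transform_poly M g w - transform_poly M (\<lambda>l. g (Suc l)) w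
       - w ^ M / fact M * binomial_transform g (Suc M)) (at w)"
proof (induction M)
  case 0
  then show ?case
    by (simp add: transform_poly_def binomial_transform_shift)
next
  case (Suc M)
  have split: "transform_poly (Suc M) h =
      (\<lambda>y. transform_poly M h y + y ^ Suc M / fact (Suc M) * binomial_transform h (Suc M))" for h
    by (intro ext) (simp add: transform_poly_def)
  have mono: "((\<lambda>y::real. y ^ Suc M / fact (Suc M)) has_real_derivative w ^ M / fact M) (at w)"
    by (rule DERIV_cong [OF DERIV_cdivide [OF DERIV_pow [of "Suc M"]]]) (simp del: of_nat_Suc)
  show ?case
    unfolding split
    by (rule DERIV_cong [OF DERIV_add [OF Suc.IH DERIV_cmult_right [OF mono]]])
      (simp add: binomial_transform_shift right_diff_distrib)
qed

lemma one_minus_D\<^sub>w_transform_poly: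
  assumes "\<And>m. m > M \<Longrightarrow> binomial_transform g m = 0"
  shows "one_minus_D\<^sub>w (\<lambda>t w. f t * transform_poly M g w) =
    (\<lambda>t w. f t * transform_poly M (\<lambda>l. g (Suc l)) w)"
proof (intro ext)
  fix t w
  have "((\<lambda>y. f t * transform_poly M g y) has_real_derivative
      f t * (transform_poly M g w - transform_poly M (\<lambda>l. g (Suc l)) w)) (at w)"
    using DERIV_cmult [OF has_real_derivative_transform_poly [of M g w], of "f t"] assms
    by simp
  then show "one_minus_D\<^sub>w (\<lambda>t w. f t * transform_poly M g w) t w =
      f t * transform_poly M (\<lambda>l. g (Suc l)) w"
    by (simp add: one_minus_D\<^sub>w_def D\<^sub>w_def DERIV_imp_deriv algebra_simps)
qed

text \<open>
  Iteration is possible because the vanishing of all differences of order above \<open>M\<close> is inherited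
  by the shifted sequence.
\<close>
lemma one_minus_D\<^sub>w_funpow_transform_poly:
  assumes "\<And>m. m > M \<Longrightarrow> binomial_transform g m = 0"
  shows "(one_minus_D\<^sub>w ^^ n) (\<lambda>t w. f t * transform_poly M g w) =
    (\<lambda>t w. f t * transform_poly M (\<lambda>l. g (l + n)) w)"
  using assms
proof (induction n arbitrary: g)
  case 0
  then show ?case by simp
next
  case (Suc n)
  have "binomial_transform (\<lambda>l. g (Suc l)) m = 0" if "m > M" for m
    using Suc.prems [of m] Suc.prems [of "Suc m"] that by (simp add: binomial_transform_shift)
  from Suc.IH [OF this] show ?case
    by (simp add: funpow_Suc_right one_minus_D\<^sub>w_transform_poly [OF Suc.prems] del: funpow.simps)
qed

section \<open>The Konhauser polynomials and their partial sums\<close>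

text \<open>
  Both \<open>(x + 1)_{n+1}\<close> and \<open>(x)_{n+1}\<close> contain the factor \<open>(x + 1)_n\<close>; the remaining factors
  \<open>x + 1 + n\<close> and \<open>x\<close> differ by \<open>n + 1\<close>.
\<close>
lemma pochhammer_div_fact_Suc:
  fixes x :: real
  shows "pochhammer (x + 1) (Suc n) / fact (Suc n) =
    pochhammer (x + 1) n / fact n + pochhammer x (Suc n) / fact (Suc n)"
proof -
  have "pochhammer (x + 1) (Suc n) = real (Suc n) * pochhammer (x + 1) n + pochhammer x (Suc n)"
    unfolding pochhammer_Suc [of "x + 1"] pochhammer_rec [of x] by (simp add: algebra_simps)
  then show ?thesis
    by (simp add: add_divide_distrib del: of_nat_Suc)
qed

definition Konhauser_node :: "real \<Rightarrow> nat \<Rightarrow> nat \<Rightarrow> real" where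
  "Konhauser_node q \<upsilon> l = (q + real l + 1) / real \<upsilon>"

lemma binomial_transform_Konhauser_node_eq_0:
  assumes "s < m"
  shows "binomial_transform (\<lambda>l. pochhammer (Konhauser_node q \<upsilon> l + c) s / fact s) m = 0"
proof -
  have node: "Konhauser_node q \<upsilon> l + c = 1 / real \<upsilon> * real l + ((q + 1) / real \<upsilon> + c)" for l
    by (simp add: Konhauser_node_def add_divide_distrib)
  show ?thesis
    using binomial_transform_cmult [of "1 / fact s"]
      binomial_transform_pochhammer_eq_0 [OF assms, of "1 / real \<upsilon>"]
    unfolding node by simp
qed

lemma Konhauser_Y_eq_transform_poly:
  "Konhauser_Y s q \<upsilon> w = transform_poly s (\<lambda>l. pochhammer (Konhauser_node q \<upsilon> l) s / fact s) w"
  using binomial_transform_cmult [of "1 / fact s"]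
  by (simp add: Konhauser_Y_def transform_poly_def binomial_transform_def Konhauser_node_def
      atLeast0AtMost sum_distrib_left mult_ac)

text \<open>
  The generating sequences add up to \<open>(x_l + 1)_s / s!\<close> by telescoping. The summands are
  truncated at different orders, but raising the truncation order of the earlier ones adds only
  vanishing differences.
\<close>
lemma sum_Konhauser_Y_eq_transform_poly:
  "(\<Sum>k=0..s. Konhauser_Y k q \<upsilon> w) =
    transform_poly s (\<lambda>l. pochhammer (Konhauser_node q \<upsilon> l + 1) s / fact s) w"
proof (induction s)
  case 0
  then show ?case by (simp add: Konhauser_Y_eq_transform_poly)
next
  case (Suc s)
  let ?g = "\<lambda>l. pochhammer (Konhauser_node q \<upsilon> l + 1) s / fact s"
  have "transform_poly (Suc s) ?g w = transform_poly s ?g w"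
    by (rule transform_poly_eq_of_le) (simp_all add: binomial_transform_Konhauser_node_eq_0)
  then show ?case
    by (simp only: sum.atLeast0_atMost_Suc Suc.IH pochhammer_div_fact_Suc transform_poly_add
        Konhauser_Y_eq_transform_poly [of "Suc s"])
qed

lemma N_Konhauser_eq_transform_poly:
  "N_Konhauser s \<upsilon> p q =
    (\<lambda>t w. N_poly s p t * transform_poly s (\<lambda>l. pochhammer (Konhauser_node q \<upsilon> l + 1) s / fact s) w)"
  by (intro ext) (simp add: N_Konhauser_def sum_Konhauser_Y_eq_transform_poly)

text \<open>
  Shifting \<open>l\<close> by \<open>\<upsilon>\<close> adds \<open>\<upsilon> / \<upsilon> = 1\<close> to the node, which is where \<open>\<upsilon> \<ge> 1\<close> enters.
\<close>
lemma one_minus_D\<^sub>w_funpow_N_Konhauser: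
  assumes "\<upsilon> \<ge> 1"
  shows "(one_minus_D\<^sub>w ^^ \<upsilon>) (N_Konhauser s \<upsilon> p q) =
    (\<lambda>t w. N_poly s p t * transform_poly s (\<lambda>l. pochhammer (Konhauser_node q \<upsilon> l + 2) s / fact s) w)"
proof -
  have "Konhauser_node q \<upsilon> (l + \<upsilon>) + 1 = Konhauser_node q \<upsilon> l + 2" for l
    using assms by (simp add: Konhauser_node_def field_simps)
  then show ?thesis
    unfolding N_Konhauser_eq_transform_poly
    by (subst one_minus_D\<^sub>w_funpow_transform_poly)
      (simp_all only: binomial_transform_Konhauser_node_eq_0)
qed

section \<open>The derivative in the first variable\<close>

text \<open>
  With \<open>a = p - n - 2\<close>, the factor \<open>k + 1\<close> from differentiation and the factor \<open>k + 1\<close> split off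
  \<open>(k + 1)!\<close> are absorbed by the two binomial coefficients, which produce \<open>n + 1\<close> and \<open>a\<close>. The
  parameter must drop by \<open>2\<close>: the upper entry \<open>a - 1\<close> equals \<open>(p - 2) - n - 1\<close>.
\<close>
lemma has_real_derivative_N_poly:
  "(N_poly (Suc n) p has_real_derivative
     real (Suc n) * (p - real (Suc n) - 1) * N_poly n (p - 2) t) (at t)"
proof -
  define a where "a = p - real n - 2"
  have poly: "N_poly (Suc n) p = (\<lambda>x. (-1) ^ Suc n *
      (\<Sum>k\<le>Suc n. fact k * (a gchoose k) * real (Suc n choose k) * (- x) ^ k))"
    unfolding N_poly_def atLeast0AtMost a_def
    by (intro ext arg_cong2 [where f = "(*)"] sum.cong refl)
      (auto simp: binomial_symmetric [symmetric] algebra_simps simp del: binomial_Suc_Suc)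
  have absorb: "real (Suc k) * (a gchoose Suc k) = a * ((a - 1) gchoose k)" for k
    using gbinomial_absorption [of k "a"] by simp
  have absorb': "real (Suc k) * real (Suc n choose Suc k) = real (Suc n) * real (n choose k)" for k
    unfolding of_nat_mult [symmetric]
    by (simp only: Suc_times_binomial_eq mult.commute [of "Suc k"])
  have coeff: "fact (Suc k) * (a gchoose Suc k) * real (Suc n choose Suc k) * real (Suc k) =
      real (Suc n) * a * (fact k * ((a - 1) gchoose k) * real (n choose k))" for k
  proof -
    have "fact (Suc k) * (a gchoose Suc k) * real (Suc n choose Suc k) * real (Suc k) =
        fact k * (real (Suc k) * (a gchoose Suc k)) * (real (Suc k) * real (Suc n choose Suc k))"
      by (simp only: fact_Suc of_nat_mult mult_ac)
    then show ?thesis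
      unfolding absorb absorb' by (simp only: mult_ac)
  qed
  have "(N_poly (Suc n) p has_real_derivative (-1) ^ Suc n *
      (\<Sum>k\<le>Suc n. fact k * (a gchoose k) * real (Suc n choose k) * (real k * (- t) ^ (k - 1) * (- 1)))) (at t)"
    unfolding poly
    by (intro DERIV_cmult DERIV_sum) (auto intro!: derivative_eq_intros)
  also have "(\<Sum>k\<le>Suc n. fact k * (a gchoose k) * real (Suc n choose k) * (real k * (- t) ^ (k - 1) * (- 1)))
      = (\<Sum>k\<le>n. - (fact (Suc k) * (a gchoose Suc k) * real (Suc n choose Suc k) * real (Suc k)) * (- t) ^ k)"
    by (subst sum.atMost_Suc_shift) (simp add: mult.assoc del: binomial_Suc_Suc fact_Suc of_nat_Suc)
  also have "\<dots> = - (real (Suc n) * a *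
      (\<Sum>k\<le>n. fact k * ((a - 1) gchoose k) * real (n choose k) * (- t) ^ k))"
    unfolding coeff sum_distrib_left sum_negf [symmetric]
    by (simp only: mult.assoc minus_mult_left)
  also have "(\<Sum>k\<le>n. fact k * ((a - 1) gchoose k) * real (n choose k) * (- t) ^ k) =
      (-1) ^ n * N_poly n (p - 2) t"
    unfolding N_poly_def a_def atLeast0AtMost mult.assoc [of "(-1)^n", symmetric]
      power_mult_distrib [symmetric]
    by (simp, intro sum.cong refl)
      (auto simp: binomial_symmetric [symmetric] algebra_simps)
  finally show ?thesis
    by (rule DERIV_cong) (simp add: a_def algebra_simps flip: power_mult_distrib)
qed

section \<open>The differential recurrence\<close>

theorem theorem24:
  fixes \<upsilon> s :: nat and p q t w :: real
  assumes "\<upsilon> \<ge> 1" and "q > -1" and "real s < (p - 1) / 2"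
  shows "D\<^sub>t (minus_one_op (one_minus_D\<^sub>w ^^ \<upsilon>) (N_Konhauser s \<upsilon> p q)) t w =
    (if s = 0 then 0
     else real s * (p - real s - 1) *
       (one_minus_D\<^sub>w ^^ \<upsilon>) (N_Konhauser (s - 1) \<upsilon> (p - 2) q) t w)"
proof -
  let ?x = "Konhauser_node q \<upsilon>"
  let ?h = "\<lambda>c n w. transform_poly n (\<lambda>l. pochhammer (?x l + c) n / fact n) w"
  have minus_one: "minus_one_op (one_minus_D\<^sub>w ^^ \<upsilon>) (N_Konhauser s \<upsilon> p q) =
      (\<lambda>t w. N_poly s p t * (?h 2 s w - ?h 1 s w))"
    unfolding minus_one_op_def one_minus_D\<^sub>w_funpow_N_Konhauser [OF assms(1)]
    by (simp add: N_Konhauser_eq_transform_poly right_diff_distrib)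
  show ?thesis
  proof (cases s)
    case 0
    then show ?thesis
      unfolding minus_one by (simp add: D\<^sub>t_def)
  next
    case (Suc n)
    have "?h 2 (Suc n) w =
        transform_poly (Suc n) (\<lambda>l. pochhammer (?x l + 2) n / fact n) w + ?h 1 (Suc n) w"
      using pochhammer_div_fact_Suc [of "?x l + 1" n for l]
      by (simp only: add.assoc one_add_one transform_poly_add [symmetric])
    also have "transform_poly (Suc n) (\<lambda>l. pochhammer (?x l + 2) n / fact n) w = ?h 2 n w"
      by (rule transform_poly_eq_of_le) (simp_all add: binomial_transform_Konhauser_node_eq_0)
    finally have diff: "?h 2 (Suc n) w - ?h 1 (Suc n) w = ?h 2 n w"
      by simp
    have "((\<lambda>t. N_poly (Suc n) p t * ?h 2 n w) has_real_derivative
        real (Suc n) * (p - real (Suc n) - 1) * N_poly n (p - 2) t * ?h 2 n w) (at t)"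
      by (rule DERIV_cmult_right [OF has_real_derivative_N_poly])
    then show ?thesis
      unfolding minus_one D\<^sub>t_def one_minus_D\<^sub>w_funpow_N_Konhauser [OF assms(1)]
      unfolding Suc diff
      by (simp add: DERIV_imp_deriv)
  qed
qed

end
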